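(* The language $\mathtt{POWER\mbox{-}EQ} = \{ a b a^7 b a^{7 \cdot 8} b a^{7 \cdot 8^2} b \cdots b a^{7 \cdot 8^n} \mid n \geq 0 \}$ can be recognized by a restarting rtQCFA with bounded error.
   Context: An rtQCFA (realtime finite automaton with quantum and classical states) has finitely many classical states and a finite-dimensional quantum register; its input head moves one cell right in every step over the input placed between a left end-marker and a right end-marker (the dollar sign \$), and in each step, depending on the classical state and scanned symbol, it applies a unitary operator followed by a projective measurement to the quantum register, the outcome determining the next classical state; it halts after reading the right end-marker. A restarting rtQCFA additionally has a restart state: on entering it the current round is terminated and the computation starts again from the initial configuration. Bounded error: members accepted with overall probability $\ge 1-\epsilon$, non-members with probability $\le\epsilon$, $\epsilon<1/2$. *)

theory Defs
  imports Complex_Main "Jordan_Normal_Form.Schur_Decomposition"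
begin

datatype 'a tape_symbol = Left_End | Input 'a | Right_End

definition tape :: "'a list \<Rightarrow> 'a tape_symbol list" where
  "tape w = Left_End # map Input w @ [Right_End]"

definition unitary_on :: "nat \<Rightarrow> complex mat \<Rightarrow> bool" where
  "unitary_on d U \<longleftrightarrow>
     U \<in> carrier_mat d d \<and> mat_adjoint U * U = 1\<^sub>m d \<and> U * mat_adjoint U = 1\<^sub>m d"

text \<open>A projective measurement with outcomes \<open>0, \<dots>, k - 1\<close> on a \<open>d\<close>-dimensional register:
  pairwise orthogonal orthogonal projections that add up to the identity (the matrix sum is
  written entrywise).\<close>

definition projective_measurement :: "nat \<Rightarrow> nat \<Rightarrow> (nat \<Rightarrow> complex mat) \<Rightarrow> bool" where
  "projective_measurement d k P \<longleftrightarrow>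
     (\<forall>r<k. P r \<in> carrier_mat d d \<and> mat_adjoint (P r) = P r \<and> P r * P r = P r) \<and>
     (\<forall>r<k. \<forall>r'<k. r \<noteq> r' \<longrightarrow> P r * P r' = 0\<^sub>m d d) \<and>
     mat d d (\<lambda>ij. \<Sum>r<k. P r $$ ij) = 1\<^sub>m d"

text \<open>In classical state \<open>s\<close> scanning \<open>x\<close>, the machine applies \<open>evolution s x\<close> to the register,
  then performs the measurement \<open>projector s x\<close> with \<open>outcomes s x\<close> many outcomes, and moves to
  \<open>next_state s x r\<close> on outcome \<open>r\<close>. The register starts in the basis vector \<open>init_basis\<close>.\<close>

record 'a rtqcfa =
  dimension :: nat
  init_basis :: nat
  states :: "nat set"
  init_state :: nat
  accept_states :: "nat set"
  restart_state :: nat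
  evolution :: "nat \<Rightarrow> 'a tape_symbol \<Rightarrow> complex mat"
  outcomes :: "nat \<Rightarrow> 'a tape_symbol \<Rightarrow> nat"
  projector :: "nat \<Rightarrow> 'a tape_symbol \<Rightarrow> nat \<Rightarrow> complex mat"
  next_state :: "nat \<Rightarrow> 'a tape_symbol \<Rightarrow> nat \<Rightarrow> nat"

text \<open>The restart state has no outgoing transitions. Non-restart states outside
  \<open>accept_states\<close> are rejecting when the right end-marker has been read.\<close>

definition restarting_rtqcfa :: "'a rtqcfa \<Rightarrow> bool" where
  "restarting_rtqcfa M \<longleftrightarrow>
     init_basis M < dimension M \<and>
     finite (states M) \<and>
     init_state M \<in> states M \<and>
     accept_states M \<subseteq> states M \<and>
     restart_state M \<in> states M \<and>
     restart_state M \<notin> accept_states M \<and>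
     restart_state M \<noteq> init_state M \<and>
     (\<forall>s \<in> states M - {restart_state M}. \<forall>x.
        unitary_on (dimension M) (evolution M s x) \<and>
        projective_measurement (dimension M) (outcomes M s x) (projector M s x) \<and>
        (\<forall>r < outcomes M s x. next_state M s x r \<in> states M))"

definition weight :: "complex vec \<Rightarrow> real" where
  "weight v = (\<Sum>i<dim_vec v. (cmod (v $ i))\<^sup>2)"

text \<open>Register states are left unnormalized along a computation branch, so the weight of the
  vector is the probability of the branch. \<open>end_prob M X s v xs\<close> is the total probability of
  the branches that leave classical state \<open>s\<close> and register \<open>v\<close>, have \<open>xs\<close> still to read,
  and end the round in a state of \<open>X\<close>; entering the restart state ends the round at once.\<close>

primrec end_prob ::
  "'a rtqcfa \<Rightarrow> nat set \<Rightarrow> nat \<Rightarrow> complex vec \<Rightarrow> 'a tape_symbol list \<Rightarrow> real" where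
  "end_prob M X s v [] = (if s \<in> X then weight v else 0)"
| "end_prob M X s v (x # xs) =
     (if s = restart_state M then (if s \<in> X then weight v else 0)
      else \<Sum>r<outcomes M s x.
        end_prob M X (next_state M s x r)
          (projector M s x r *\<^sub>v (evolution M s x *\<^sub>v v)) xs)"

definition round_prob :: "'a rtqcfa \<Rightarrow> nat set \<Rightarrow> 'a list \<Rightarrow> real" where
  "round_prob M X w =
     end_prob M X (init_state M) (unit_vec (dimension M) (init_basis M)) (tape w)"

text \<open>The \<open>k\<close>-th summand is the probability that the first \<open>k\<close> rounds end in a restart and
  the following round accepts. If a round restarts with probability \<open>1\<close>, every summand is \<open>0\<close>.\<close>

definition accept_prob :: "'a rtqcfa \<Rightarrow> 'a list \<Rightarrow> real" where
  "accept_prob M w =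
     (\<Sum>k. round_prob M {restart_state M} w ^ k * round_prob M (accept_states M) w)"

definition recognizes_bounded_error :: "'a rtqcfa \<Rightarrow> 'a list set \<Rightarrow> bool" where
  "recognizes_bounded_error M L \<longleftrightarrow>
     (\<exists>\<epsilon>. 0 \<le> \<epsilon> \<and> \<epsilon> < 1 / 2 \<and>
        (\<forall>w. (w \<in> L \<longrightarrow> accept_prob M w \<ge> 1 - \<epsilon>) \<and>
             (w \<notin> L \<longrightarrow> accept_prob M w \<le> \<epsilon>)))"

datatype letter = a | b

definition power_eq_word :: "nat \<Rightarrow> letter list" where
  "power_eq_word n = a # concat (map (\<lambda>i. b # replicate (7 * 8 ^ i) a) [0..<Suc n])"

definition POWER_EQ :: "letter list set" where
  "POWER_EQ = range power_eq_word"

end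

theory Submission
  imports Defs
begin

text \<open>
  Write \<open>w = a b u\<close> and let \<open>\<theta> = arccos (3/5)\<close>. The register is a real qubit. After the prefix
  \<open>a b\<close> the machine splits into three branches. One branch rotates by \<open>8\<theta>\<close> per letter in the
  first, third, \<dots> block of \<open>u\<close> and back by \<open>\<theta>\<close> per letter in the following block; a measurement
  then rejects with probability \<open>sin\<^sup>2 (k\<theta>)\<close>, where \<open>k = 8 x - y\<close> for the lengths \<open>x\<close> and
  \<open>y\<close> of the two blocks. The second branch does the same with the blocks shifted by one,
  starting from the angle \<open>7\<theta>\<close>. The third branch accepts after surviving one coin toss of bias
  \<open>25\<^sup>-\<^sup>9\<close> per tape cell. Since \<open>5\<^sup>k sin (k\<theta>)\<close> is an integer that is not divisible by 5 for
  \<open>k > 0\<close>, the first nonzero \<open>k\<close> on a non-member makes its branch reject with probability at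
  least \<open>1 / 25 ^ \<bar>k\<bar>\<close>, which dominates the acceptance probability, whereas members are never
  rejected. Inputs without the prefix \<open>a b\<close> always restart.
\<close>

section \<open>Machines whose register is a rotating real qubit\<close>

definition rotation_mat :: "real \<Rightarrow> complex mat" where
  "rotation_mat \<alpha> = mat 2 2 (\<lambda>(i, j).
     of_real (if i = j then cos \<alpha> else if i = 0 then - sin \<alpha> else sin \<alpha>))"

definition basis_projector :: "nat \<Rightarrow> complex mat" where
  "basis_projector r = mat 2 2 (\<lambda>(i, j). if i = r \<and> j = r then 1 else 0)"

text \<open>The model demands a measurement in every step, so the steps that should leave the
  register alone get the one-outcome measurement given by the identity.\<close>

definition rotation_machine ::
  "nat set \<Rightarrow> nat set \<Rightarrow> nat \<Rightarrow> (nat \<Rightarrow> 'a tape_symbol \<Rightarrow> real) \<Rightarrow>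
   (nat \<Rightarrow> 'a tape_symbol \<Rightarrow> bool) \<Rightarrow> (nat \<Rightarrow> 'a tape_symbol \<Rightarrow> nat \<Rightarrow> nat) \<Rightarrow> 'a rtqcfa" where
  "rotation_machine Q A q ang meas nxt =
     \<lparr>dimension = 2, init_basis = 0, states = Q, init_state = 0, accept_states = A,
      restart_state = q,
      evolution = (\<lambda>s x. rotation_mat (ang s x)),
      outcomes = (\<lambda>s x. if meas s x then 2 else 1),
      projector = (\<lambda>s x. if meas s x then basis_projector else (\<lambda>_. 1\<^sub>m 2)),
      next_state = nxt\<rparr>"

lemma unitary_rotation_mat: "unitary_on 2 (rotation_mat \<alpha>)"
proof -
  have adj: "mat_adjoint (rotation_mat \<alpha>) = rotation_mat (- \<alpha>)"
    by (rule eq_matI)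
      (auto simp: mat_adjoint_def rotation_mat_def mat_of_rows_def less_2_cases_iff)
  have mult: "rotation_mat \<beta> * rotation_mat (- \<beta>) = 1\<^sub>m 2" for \<beta>
  proof -
    have "complex_of_real (cos \<beta>) * of_real (cos \<beta>) + of_real (sin \<beta>) * of_real (sin \<beta>) = 1"
      by (simp flip: of_real_mult of_real_add)
    then show ?thesis
      by (intro eq_matI; simp add: less_2_cases_iff; (elim disjE)?)
        (simp_all add: rotation_mat_def scalar_prod_def numeral_2_eq_2 add.commute)
  qed
  show ?thesis
    using mult[of \<alpha>] mult[of "- \<alpha>"] unfolding unitary_on_def adj
    by (auto simp: rotation_mat_def)
qed

lemma projective_measurement_basis: "projective_measurement 2 2 basis_projector"
proof -
  have "mat_adjoint (basis_projector r) = basis_projector r" if "r < 2" for r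
    by (rule eq_matI)
      (auto simp: mat_adjoint_def basis_projector_def mat_of_rows_def)
  moreover have "basis_projector r * basis_projector r' =
      (if r = r' then basis_projector r else 0\<^sub>m 2 2)" if "r < 2" for r r'
    using that
    by (intro eq_matI)
      (auto simp: basis_projector_def scalar_prod_def less_2_cases_iff numeral_2_eq_2)
  moreover have "mat 2 2 (\<lambda>ij. \<Sum>r<2. basis_projector r $$ ij) = 1\<^sub>m 2"
    by (rule eq_matI) (auto simp: basis_projector_def less_2_cases_iff numeral_2_eq_2)
  ultimately show ?thesis
    unfolding projective_measurement_def by (auto simp: basis_projector_def)
qed

lemma projective_measurement_trivial: "projective_measurement d 1 (\<lambda>_. 1\<^sub>m d)"
proof -
  have "mat_adjoint (1\<^sub>m d) = (1\<^sub>m d :: complex mat)"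
    by (rule eq_matI) (auto simp: mat_adjoint_def mat_of_rows_def)
  then show ?thesis
    unfolding projective_measurement_def by (auto intro!: eq_matI)
qed

lemma restarting_rotation_machine:
  assumes "finite Q" "0 \<in> Q" "A \<subseteq> Q" "q \<in> Q" "q \<notin> A" "q \<noteq> 0"
    and "\<And>s x r. s \<in> Q \<Longrightarrow> s \<noteq> q \<Longrightarrow> nxt s x r \<in> Q"
  shows "restarting_rtqcfa (rotation_machine Q A q ang meas nxt)"
proof -
  let ?M = "rotation_machine Q A q ang meas nxt"
  have "projective_measurement (dimension ?M) (outcomes ?M s x) (projector ?M s x)" for s x
    using projective_measurement_basis projective_measurement_trivial
    by (cases "meas s x") (simp_all add: rotation_machine_def)
  moreover have "unitary_on (dimension ?M) (evolution ?M s x)" for s x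
    by (simp add: rotation_machine_def unitary_rotation_mat)
  ultimately show ?thesis
    unfolding restarting_rtqcfa_def using assms by (simp add: rotation_machine_def)
qed

section \<open>Register states in polar form\<close>

text \<open>This family is closed under rotations and both projectors, so a signed amplitude and an
  angle describe every branch.\<close>

definition polar_vec :: "real \<Rightarrow> real \<Rightarrow> complex vec" where
  "polar_vec t \<alpha> = vec 2 (\<lambda>i. of_real (t * (if i = 0 then cos \<alpha> else sin \<alpha>)))"

lemma sum_lessThan_2: "(\<Sum>i<2. f i) = f 0 + f (Suc 0)"
  by (simp add: numeral_2_eq_2)

lemma weight_polar_vec [simp]: "weight (polar_vec t \<alpha>) = t\<^sup>2"
proof -
  have "weight (polar_vec t \<alpha>) = t\<^sup>2 * ((cos \<alpha>)\<^sup>2 + (sin \<alpha>)\<^sup>2)"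
    unfolding weight_def polar_vec_def
    by (simp add: sum_lessThan_2 norm_mult power_mult_distrib distrib_left
        del: sin_cos_squared_add sin_cos_squared_add2)
  then show ?thesis by simp
qed

lemma unit_vec_eq_polar_vec: "unit_vec 2 0 = polar_vec 1 0"
  by (rule eq_vecI) (auto simp: polar_vec_def)

lemma rotation_mat_polar_vec: "rotation_mat \<beta> *\<^sub>v polar_vec t \<alpha> = polar_vec t (\<alpha> + \<beta>)"
  by (rule eq_vecI)
    (auto simp: rotation_mat_def polar_vec_def scalar_prod_def less_2_cases_iff numeral_2_eq_2
      cos_add sin_add algebra_simps)

text \<open>A measurement erases the angle: it becomes 0 or \<open>pi / 2\<close> depending on the
  outcome. This is what resets the counter between blocks.\<close>

lemma basis_projector_polar_vec:
  "basis_projector 0 *\<^sub>v polar_vec t \<alpha> = polar_vec (t * cos \<alpha>) 0"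
  "basis_projector (Suc 0) *\<^sub>v polar_vec t \<alpha> = polar_vec (t * sin \<alpha>) (pi / 2)"
  by (rule eq_vecI; auto simp: basis_projector_def polar_vec_def scalar_prod_def
      less_2_cases_iff numeral_2_eq_2)+

lemma one_mat_polar_vec: "1\<^sub>m 2 *\<^sub>v polar_vec t \<alpha> = polar_vec t \<alpha>"
  by (rule one_mult_mat_vec) (simp add: polar_vec_def)

context
  fixes Q A :: "nat set" and q :: nat and ang :: "nat \<Rightarrow> 'a tape_symbol \<Rightarrow> real"
    and meas :: "nat \<Rightarrow> 'a tape_symbol \<Rightarrow> bool"
    and nxt :: "nat \<Rightarrow> 'a tape_symbol \<Rightarrow> nat \<Rightarrow> nat"
    and M :: "'a rtqcfa"
  defines "M \<equiv> rotation_machine Q A q ang meas nxt"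
begin

lemma end_prob_restart_state: "end_prob M X q v xs = (if q \<in> X then weight v else 0)"
  by (cases xs) (auto simp: M_def rotation_machine_def)

lemma end_prob_rotation_Cons:
  assumes "s \<noteq> q"
  shows "end_prob M X s (polar_vec t \<alpha>) (x # xs) =
    (let \<beta> = \<alpha> + ang s x in
     if meas s x then end_prob M X (nxt s x 0) (polar_vec (t * cos \<beta>) 0) xs +
                      end_prob M X (nxt s x (Suc 0)) (polar_vec (t * sin \<beta>) (pi / 2)) xs
     else end_prob M X (nxt s x 0) (polar_vec t \<beta>) xs)"
  using assms
  by (simp add: M_def rotation_machine_def Let_def rotation_mat_polar_vec one_mat_polar_vec
      basis_projector_polar_vec sum_lessThan_2)

text \<open>Evolution is linear and weight is quadratic, so branch probabilities factor out and runs
  need only be studied from amplitude 1.\<close>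

lemma end_prob_rotation_scale:
  "end_prob M X s (polar_vec t \<alpha>) xs = t\<^sup>2 * end_prob M X s (polar_vec 1 \<alpha>) xs"
proof (induction xs arbitrary: s t \<alpha>)
  case Nil
  then show ?case by simp
next
  case (Cons x xs)
  show ?case
  proof (cases "s = q")
    case True
    then show ?thesis by (simp add: end_prob_restart_state del: end_prob.simps(2))
  next
    case False
    let ?e = "\<lambda>s t \<alpha>. end_prob M X s (polar_vec t \<alpha>) xs"
    have scale: "?e s (t * v) \<alpha> = t\<^sup>2 * ?e s v \<alpha>" for s v \<alpha>
      unfolding Cons.IH[of s "t * v"] Cons.IH[of s v] power_mult_distrib by (rule mult.assoc)
    show ?thesis
      unfolding end_prob_rotation_Cons[OF False] Let_def scale mult_1 distrib_left[symmetric]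
      by (cases "meas s x") (simp_all only: if_True if_False Cons.IH[of _ t])
  qed
qed

lemma end_prob_rotation_UNIV: "end_prob M UNIV s (polar_vec t \<alpha>) xs = t\<^sup>2"
proof (induction xs arbitrary: s t \<alpha>)
  case (Cons x xs)
  show ?case
  proof (cases "s = q")
    case False
    have "(t * cos \<beta>)\<^sup>2 + (t * sin \<beta>)\<^sup>2 = t\<^sup>2" for \<beta>
      by (simp add: power_mult_distrib flip: distrib_left)
    with False show ?thesis
      by (simp add: end_prob_rotation_Cons Let_def Cons.IH del: end_prob.simps(2))
  qed (simp add: end_prob_restart_state del: end_prob.simps(2))
qed simp

lemma end_prob_rotation_nonneg: "end_prob M X s (polar_vec t \<alpha>) xs \<ge> 0"
proof (induction xs arbitrary: s t \<alpha>)
  case (Cons x xs)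
  then show ?case
    by (cases "s = q") (auto simp: end_prob_restart_state end_prob_rotation_Cons Let_def
        simp del: end_prob.simps(2))
qed simp

lemma end_prob_rotation_closed:
  assumes "S \<inter> X = {}" "\<And>s x r. s \<in> S \<Longrightarrow> s \<noteq> q \<Longrightarrow> nxt s x r \<in> S" "s \<in> S"
  shows "end_prob M X s (polar_vec t \<alpha>) xs = 0"
  using assms(3)
proof (induction xs arbitrary: s t \<alpha>)
  case Nil
  then show ?case using assms(1) by auto
next
  case (Cons x xs)
  then show ?case using assms(1,2)
    by (cases "s = q") (auto simp: end_prob_restart_state end_prob_rotation_Cons Let_def
        simp del: end_prob.simps(2))
qed

lemma round_prob_rotation:
  "round_prob M X w = end_prob M X 0 (polar_vec 1 0) (tape w)"
  by (simp add: round_prob_def M_def rotation_machine_def unit_vec_eq_polar_vec)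

end

lemma end_prob_Un:
  assumes "X \<inter> Y = {}"
  shows "end_prob M (X \<union> Y) s v xs = end_prob M X s v xs + end_prob M Y s v xs"
proof (induction xs arbitrary: s v)
  case Nil
  then show ?case using assms by auto
next
  case (Cons x xs)
  then show ?case using assms by (auto simp: sum.distrib)
qed

lemma accept_prob_eq:
  assumes "0 \<le> round_prob M {restart_state M} w" "round_prob M {restart_state M} w < 1"
  shows "accept_prob M w =
    round_prob M (accept_states M) w / (1 - round_prob M {restart_state M} w)"
  using assms unfolding accept_prob_def
  by (subst suminf_mult2[symmetric]) (auto simp: suminf_geometric intro: summable_geometric)

section \<open>The 3-4-5 angle\<close>

definition pythagorean_angle :: real where
  "pythagorean_angle = arccos (3 / 5)"

lemma cos_pythagorean_angle: "cos pythagorean_angle = 3 / 5"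
  by (simp add: pythagorean_angle_def)

lemma sin_pythagorean_angle: "sin pythagorean_angle = 4 / 5"
  unfolding pythagorean_angle_def
  by (subst sin_arccos) (auto simp: power2_eq_square real_sqrt_divide)

text \<open>The integers are the parts of \<open>(3 + 4i) ^ Suc k\<close>. Their residues never
  change because \<open>(3 + 4i)^2 = -7 + 24i\<close> is congruent to \<open>3 + 4i\<close> modulo
  5.\<close>

lemma multiple_of_pythagorean_angle:
  "\<exists>S C :: int. sin (real (Suc k) * pythagorean_angle) = of_int S / 5 ^ Suc k \<and>
     cos (real (Suc k) * pythagorean_angle) = of_int C / 5 ^ Suc k \<and>
     S mod 5 = 4 \<and> C mod 5 = 3"
proof (induction k)
  case 0
  show ?case
    by (rule exI[of _ 4], rule exI[of _ 3])
      (simp add: cos_pythagorean_angle sin_pythagorean_angle)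
next
  case (Suc k)
  then obtain S C :: int where *:
    "sin (real (Suc k) * pythagorean_angle) = of_int S / 5 ^ Suc k"
    "cos (real (Suc k) * pythagorean_angle) = of_int C / 5 ^ Suc k"
    "S mod 5 = 4" "C mod 5 = 3"
    by blast
  have angle: "real (Suc (Suc k)) * pythagorean_angle =
      real (Suc k) * pythagorean_angle + pythagorean_angle"
    by (simp add: algebra_simps)
  show ?case
  proof (intro exI conjI)
    show "sin (real (Suc (Suc k)) * pythagorean_angle) = of_int (3 * S + 4 * C) / 5 ^ Suc (Suc k)"
      unfolding angle sin_add cos_pythagorean_angle sin_pythagorean_angle *(1,2)
      by (simp add: field_simps)
    show "cos (real (Suc (Suc k)) * pythagorean_angle) = of_int (3 * C - 4 * S) / 5 ^ Suc (Suc k)"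
      unfolding angle cos_add cos_pythagorean_angle sin_pythagorean_angle *(1,2)
      by (simp add: field_simps)
    obtain m n where "S = 4 + 5 * m" "C = 3 + 5 * n"
      using *(3,4) by (metis mod_mult_div_eq)
    then have eq: "3 * S + 4 * C = 4 + 5 * (4 + 3 * m + 4 * n)"
      "3 * C - 4 * S = 3 + 5 * (3 * n - 4 * m - 2)"
      by simp_all
    have "(4 + 5 * x) mod 5 = 4" "(3 + 5 * x) mod 5 = 3" for x :: int
      by simp_all
    then show "(3 * S + 4 * C) mod 5 = 4" "(3 * C - 4 * S) mod 5 = 3"
      by (simp_all only: eq)
  qed
qed

text \<open>The numerator of the sine is an integer with residue 4 modulo 5, hence nonzero, so its
  square is at least 1.\<close>

lemma sin_squared_lower_bound:
  fixes k :: int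
  assumes "k \<noteq> 0"
  shows "(sin (of_int k * pythagorean_angle))\<^sup>2 \<ge> (1 / 25) ^ nat \<bar>k\<bar>"
proof -
  obtain m where m: "nat \<bar>k\<bar> = Suc m"
    using assms by (cases "nat \<bar>k\<bar>") auto
  have "real_of_int k = real (Suc m) \<or> real_of_int k = - real (Suc m)"
    using m by linarith
  then have eq: "(sin (of_int k * pythagorean_angle))\<^sup>2 = (sin (real (Suc m) * pythagorean_angle))\<^sup>2"
    by (elim disjE) (simp_all only: mult_minus_left sin_minus power2_minus)
  obtain S :: int where S: "sin (real (Suc m) * pythagorean_angle) = of_int S / 5 ^ Suc m"
    "S mod 5 = 4"
    using multiple_of_pythagorean_angle by blast
  have "S \<noteq> 0" using S(2) by auto
  then have "1 \<le> \<bar>S\<bar>" by simp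
  then have "1 \<le> S\<^sup>2" by (metis abs_le_square_iff abs_one one_power2)
  then have "(1::real) \<le> (of_int S)\<^sup>2"
    by (metis of_int_1_le_iff of_int_power)
  moreover have "((5::real) ^ Suc m)\<^sup>2 = 25 ^ Suc m"
    by (simp add: power2_eq_square del: power_Suc flip: power_mult_distrib)
  ultimately show ?thesis
    unfolding eq S(1) m power_divide by (simp add: divide_right_mono del: power_Suc)
qed

section \<open>The counter condition\<close>

text \<open>The flag tells whether the current block is being counted up, and \<open>k\<close> is the angle of the
  register in units of the 3-4-5 angle. A branch never rejects iff \<open>k\<close> is \<open>0\<close> whenever a block
  that is counted down ends.\<close>

fun balanced :: "bool \<Rightarrow> int \<Rightarrow> letter list \<Rightarrow> bool" where
  "balanced True k [] = True"
| "balanced True k (a # u) = balanced True (k + 8) u"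
| "balanced True k (b # u) = balanced False k u"
| "balanced False k [] = (k = 0)"
| "balanced False k (a # u) = balanced False (k - 1) u"
| "balanced False k (b # u) = (k = 0 \<and> balanced True 0 u)"

text \<open>\<open>chain 7 n\<close> is what follows the prefix \<open>a b\<close> in a member;
  peeling blocks from the front matches the reading order.\<close>

primrec chain :: "nat \<Rightarrow> nat \<Rightarrow> letter list" where
  "chain c 0 = replicate c a"
| "chain c (Suc n) = replicate c a @ b # chain (8 * c) n"

lemma balanced_replicate:
  "balanced True k (replicate m a @ u) = balanced True (k + 8 * int m) u"
  "balanced False k (replicate m a @ u) = balanced False (k - int m) u"
  by (induction m arbitrary: k) (auto simp: algebra_simps)

text \<open>At each \<open>b\<close> the two branches swap roles: the one counting down from
  \<open>c\<close> has reached 0 and starts counting up, the other arrives with \<open>8 * c\<close>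
  and counts down. Hence the pair of claims recurs with \<open>8 * c\<close>.\<close>

lemma balanced_chain: "balanced False (int c) (chain c n) \<and> balanced True 0 (chain c n)"
proof (induction n arbitrary: c)
  case 0
  show ?case
    using balanced_replicate[of _ c "[]"] by simp
next
  case (Suc n)
  then show ?case
    using Suc.IH[of "8 * c"] by (simp add: balanced_replicate)
qed

lemma letters_cases:
  obtains m where "u = replicate m a" | m u' where "u = replicate m a @ b # u'"
proof (induction u)
  case Nil
  from Nil(1)[of 0] show ?case by simp
next
  case (Cons x u)
  show ?case
  proof (cases x)
    case a
    show ?thesis
      by (rule Cons.IH) (metis Cons.prems a append_Cons replicate_Suc)+
  next
    case b
    with Cons.prems(2)[of 0 u] show ?thesis by simp
  qed
qed

lemma balanced_imp_chain:
  assumes "balanced False (int c) u" "balanced True 0 u"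
  shows "\<exists>n. u = chain c n"
  using assms
proof (induction "length u" arbitrary: u c rule: less_induct)
  case less
  show ?case
  proof (cases u rule: letters_cases)
    case (1 m)
    then show ?thesis
      using less.prems(1) balanced_replicate(2)[of "int c" m "[]"]
      by (intro exI[of _ 0]) simp
  next
    case (2 m u')
    \<comment> \<open>The countdown from \<open>c\<close> must end at 0, which forces
      \<open>m = c\<close>; the other branch then carries \<open>8 * c\<close> into the next
      block.\<close>
    with less.prems have "m = c" "balanced True 0 u'" "balanced False (int (8 * c)) u'"
      by (auto simp: balanced_replicate)
    with less.hyps[of u' "8 * c"] 2 obtain n where "u' = chain (8 * c) n" by auto
    with 2 \<open>m = c\<close> show ?thesis by (intro exI[of _ "Suc n"]) simp
  qed
qed

lemma concat_blocks_eq_chain: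
  "concat (map (\<lambda>i. b # replicate (c * 8 ^ i) a) [0..<Suc n]) = b # chain c n"
proof (induction n arbitrary: c)
  case (Suc n)
  \<comment> \<open>Splitting off block 0 shifts the remaining exponents by one, which amounts to
    replacing \<open>c\<close> by \<open>8 * c\<close>.\<close>
  have "[0..<Suc (Suc n)] = 0 # map Suc [0..<Suc n]"
    by (subst upt_conv_Cons) (simp_all only: map_Suc_upt zero_less_Suc)
  then show ?case
    using Suc.IH[of "8 * c"] by (simp add: o_def algebra_simps del: upt_Suc)
qed simp

lemma POWER_EQ_iff:
  "w \<in> POWER_EQ \<longleftrightarrow> (\<exists>u. w = a # b # u \<and> balanced False 7 u \<and> balanced True 0 u)"
proof -
  have "power_eq_word n = a # b # chain 7 n" for n
    unfolding power_eq_word_def by (simp only: concat_blocks_eq_chain)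
  then show ?thesis
    using balanced_chain[of 7] balanced_imp_chain[of 7]
    unfolding POWER_EQ_def by fastforce
qed

section \<open>The machine for POWER-EQ\<close>

text \<open>State 0 reads the first letter; 1 and 2 await the first \<open>b\<close>; 3 counts a block up and 4
  counts one down; 5 tosses coins; 6 accepts, 7 rejects and 8 restarts. The summand \<open>- pi / 2\<close> of
  the angle in state 2 and the outcome 1 kept in state 5 are due to these states being entered
  with the register in the second basis vector.\<close>

definition power_eq_angle :: "nat \<Rightarrow> letter tape_symbol \<Rightarrow> real" where
  "power_eq_angle s x =
     (if s = 0 \<and> x = Input a \<or> s = 1 then pi / 4
      else if s = 2 then 7 * pythagorean_angle - pi / 2
      else if s = 3 \<and> x = Input a then 8 * pythagorean_angle
      else if s = 4 \<and> x = Input a then - pythagorean_angle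
      else if s = 5 then arccos ((1 / 5) ^ 9)
      else 0)"

definition power_eq_measured :: "nat \<Rightarrow> letter tape_symbol \<Rightarrow> bool" where
  "power_eq_measured s x \<longleftrightarrow>
     s = 0 \<and> x = Input a \<or> s = 1 \<and> x = Input b \<or> s = 4 \<and> x \<noteq> Input a \<or> s = 5"

definition power_eq_next :: "nat \<Rightarrow> letter tape_symbol \<Rightarrow> nat \<Rightarrow> nat" where
  "power_eq_next s x r =
     (if s = 0 then (if x = Left_End then 0 else if x = Input a then (if r = 0 then 1 else 2) else 8)
      else if s = 1 then (if x = Input b then (if r = 0 then 3 else 5) else 8)
      else if s = 2 then (if x = Input b then 4 else 8)
      else if s = 3 then (if x = Input a then 3 else if x = Input b then 4 else 8)
      else if s = 4 then
        (if x = Input a then 4 else if r \<noteq> 0 then 7 else if x = Input b then 3 else 8)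
      else if s = 5 then (if r = 0 then 8 else if x = Right_End then 6 else 5)
      else s)"

definition power_eq_machine :: "letter rtqcfa" where
  "power_eq_machine =
     rotation_machine {..8} {6} 8 power_eq_angle power_eq_measured power_eq_next"

abbreviation run :: "nat set \<Rightarrow> nat \<Rightarrow> real \<Rightarrow> letter tape_symbol list \<Rightarrow> real" where
  "run X s \<alpha> xs \<equiv> end_prob power_eq_machine X s (polar_vec 1 \<alpha>) xs"

lemma restarting_power_eq_machine: "restarting_rtqcfa power_eq_machine"
  unfolding power_eq_machine_def
  by (rule restarting_rotation_machine) (auto simp: power_eq_next_def)

lemma run_Nil: "run X s \<alpha> [] = (if s \<in> X then 1 else 0)"
  by simp

lemma run_restart: "run X 8 \<alpha> xs = (if 8 \<in> X then 1 else 0)"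
  unfolding power_eq_machine_def by (simp add: end_prob_restart_state)

lemma run_Cons:
  assumes "s \<noteq> 8"
  shows "run X s \<alpha> (x # xs) =
    (let \<beta> = \<alpha> + power_eq_angle s x in
     if power_eq_measured s x
     then (cos \<beta>)\<^sup>2 * run X (power_eq_next s x 0) 0 xs +
          (sin \<beta>)\<^sup>2 * run X (power_eq_next s x (Suc 0)) (pi / 2) xs
     else run X (power_eq_next s x 0) \<beta> xs)"
  unfolding power_eq_machine_def end_prob_rotation_Cons[OF assms] Let_def
  by (subst (1 2) end_prob_rotation_scale) simp

lemmas run_simps = run_Nil run_restart run_Cons power_eq_angle_def power_eq_measured_def
  power_eq_next_def Let_def

lemma run_nonneg: "run X s \<alpha> xs \<ge> 0"
  unfolding power_eq_machine_def by (rule end_prob_rotation_nonneg)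

lemma run_UNIV: "run UNIV s \<alpha> xs = 1"
  unfolding power_eq_machine_def by (simp add: end_prob_rotation_UNIV)

lemma run_reject_state: "run X 7 \<alpha> xs = (if 7 \<in> X then 1 else 0)"
  by (induction xs arbitrary: \<alpha>) (simp_all add: run_simps del: end_prob.simps)

abbreviation input_tail :: "letter list \<Rightarrow> letter tape_symbol list" where
  "input_tail u \<equiv> map Input u @ [Right_End]"

section \<open>Behaviour of the three branches\<close>

lemma run_accept_counting:
  assumes "s \<in> {3, 4, 7, 8}"
  shows "run {6} s \<alpha> xs = 0"
  unfolding power_eq_machine_def
  by (rule end_prob_rotation_closed[of "{3, 4, 7, 8}"]) (use assms in \<open>auto simp: power_eq_next_def\<close>)

text \<open>State 5 is always entered at angle \<open>pi / 2\<close>, where the sine after the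
  rotation is the cosine of the arccos. The right end-marker costs one more toss, hence
  \<open>Suc\<close>.\<close>

lemma run_accept_coin: "run {6} 5 (pi / 2) (input_tail u) = ((1 / 25) ^ 9) ^ Suc (length u)"
proof -
  have "sin (pi / 2 + arccos ((1 / 5) ^ 9)) = (1 / 5 :: real) ^ 9"
  proof -
    have "cos (arccos ((1 / 5) ^ 9)) = (1 / 5 :: real) ^ 9"
    proof (rule cos_arccos)
      have "0 \<le> (1 / 5 :: real) ^ 9" by (rule zero_le_power) simp
      then show "- 1 \<le> (1 / 5 :: real) ^ 9" by linarith
      show "(1 / 5 :: real) ^ 9 \<le> 1" by (rule power_le_one) simp_all
    qed
    then show ?thesis by (simp add: sin_add)
  qed
  then have sin: "(sin (pi / 2 + arccos ((1 / 5) ^ 9)))\<^sup>2 = (1 / 25 :: real) ^ 9"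
    by (simp only: power2_eq_square power_mult_distrib[symmetric]) simp
  show ?thesis
    by (induction u) (simp_all add: run_simps sin del: end_prob.simps)
qed

text \<open>At the right end-marker state 5 moves to 6 or 8, so no run stops in 5 itself, which
  would count as rejecting.\<close>

lemma run_reject_coin: "run (- {6, 8}) 5 \<alpha> (input_tail u) = 0"
  by (induction u arbitrary: \<alpha>) (simp_all add: run_simps del: end_prob.simps)

lemma run_reject_balanced:
  "balanced up k u \<Longrightarrow>
    run (- {6, 8}) (if up then 3 else 4) (of_int k * pythagorean_angle) (input_tail u) = 0"
  by (induction up k u rule: balanced.induct)
    (simp_all add: run_simps algebra_simps del: end_prob.simps)

text \<open>The exponent is a potential: a letter changes \<bar>k\<bar> by at most 8 and shortens
  the rest by 1, so the exponent never grows. At the first failed test it still bounds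
  \<bar>k\<bar>, and the sine bound applies.\<close>

lemma run_reject_unbalanced:
  "\<not> balanced up k u \<Longrightarrow>
    run (- {6, 8}) (if up then 3 else 4) (of_int k * pythagorean_angle) (input_tail u)
      \<ge> (1 / 25) ^ (nat \<bar>k\<bar> + 8 * length u)"
proof (induction up k u rule: balanced.induct)
  case (2 k u)
  have "(1 / 25 :: real) ^ (nat \<bar>k\<bar> + 8 * length (a # u)) \<le> (1 / 25) ^ (nat \<bar>k + 8\<bar> + 8 * length u)"
    by (rule power_decreasing) auto
  from order_trans[OF this "2.IH"] "2.prems" show ?case
    by (simp add: run_simps algebra_simps del: end_prob.simps)
next
  case (3 k u)
  have "(1 / 25 :: real) ^ (nat \<bar>k\<bar> + 8 * length (b # u)) \<le> (1 / 25) ^ (nat \<bar>k\<bar> + 8 * length u)"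
    by (rule power_decreasing) auto
  from order_trans[OF this "3.IH"] "3.prems" show ?case
    by (simp add: run_simps algebra_simps del: end_prob.simps)
next
  case (4 k)
  then show ?case
    using sin_squared_lower_bound[of k]
    by (simp add: run_simps run_reject_state del: end_prob.simps)
next
  case (5 k u)
  have "(1 / 25 :: real) ^ (nat \<bar>k\<bar> + 8 * length (a # u)) \<le> (1 / 25) ^ (nat \<bar>k - 1\<bar> + 8 * length u)"
    by (rule power_decreasing) auto
  from order_trans[OF this "5.IH"] "5.prems" show ?case
    by (simp add: run_simps algebra_simps del: end_prob.simps)
next
  case (6 k u)
  show ?case
  proof (cases "k = 0")
    case True
    have "(1 / 25 :: real) ^ (nat \<bar>0 :: int\<bar> + 8 * length (b # u)) \<le>
        (1 / 25) ^ (nat \<bar>0 :: int\<bar> + 8 * length u)"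
      by (rule power_decreasing) auto
    from order_trans[OF this "6.IH"] True "6.prems" show ?thesis
      by (simp add: run_simps del: end_prob.simps)
  next
    case False
    have "(1 / 25 :: real) ^ (nat \<bar>k\<bar> + 8 * length (b # u)) \<le> (1 / 25) ^ nat \<bar>k\<bar>"
      by (rule power_decreasing) auto
    also have "\<dots> \<le> (sin (of_int k * pythagorean_angle))\<^sup>2"
      by (rule sin_squared_lower_bound[OF False])
    also have "\<dots> \<le> (cos (of_int k * pythagorean_angle))\<^sup>2 * run (- {6, 8}) 3 0 (input_tail u) +
        (sin (of_int k * pythagorean_angle))\<^sup>2"
      by (simp add: run_nonneg)
    finally show ?thesis
      by (simp add: run_simps run_reject_state del: end_prob.simps)
  qed
qed simp

section \<open>From branches to the acceptance probability\<close>

lemma cos_sin_squared_45: "(cos (pi / 4))\<^sup>2 = (1 / 2 :: real)" "(sin (pi / 4))\<^sup>2 = (1 / 2 :: real)"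
  by (simp_all add: cos_45 sin_45 power_divide)

text \<open>The rotations by \<open>pi / 4\<close> are fair coins: one toss on \<open>a\<close>
  splits off the branch of weight 1/2, a second one on \<open>b\<close> halves the rest.\<close>

lemma run_prefix:
  "run X 0 0 (tape (a # b # u)) =
    run X 3 0 (input_tail u) / 4 + run X 5 (pi / 2) (input_tail u) / 4 +
    run X 4 (7 * pythagorean_angle) (input_tail u) / 2"
  unfolding tape_def
  by (simp add: run_simps cos_sin_squared_45 del: end_prob.simps)

lemma run_accept_without_prefix:
  assumes "\<nexists>u. w = a # b # u"
  shows "run {6} 0 0 (tape w) = 0"
proof -
  consider "w = []" | v where "w = b # v" | "w = [a]" | v where "w = a # a # v"
    using assms by (metis (full_types) letter.exhaust list.exhaust)
  then show ?thesis
    by cases (simp_all add: tape_def run_simps del: end_prob.simps)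
qed

text \<open>A round restarts with the remaining probability \<open>1 - (p + r)\<close>, so the
  geometric series sums to \<open>p / (p + r)\<close>.\<close>

lemma accept_prob_power_eq:
  fixes w :: "letter list"
  defines "p \<equiv> run {6} 0 0 (tape w)" and "r \<equiv> run (- {6, 8}) 0 0 (tape w)"
  shows "p > 0 \<Longrightarrow> accept_prob power_eq_machine w = p / (p + r)"
    and "p = 0 \<Longrightarrow> accept_prob power_eq_machine w = 0"
proof -
  have round: "round_prob power_eq_machine X w = run X 0 0 (tape w)" for X
    unfolding power_eq_machine_def by (rule round_prob_rotation)
  have fields: "restart_state power_eq_machine = 8" "accept_states power_eq_machine = {6}"
    by (simp_all add: power_eq_machine_def rotation_machine_def)
  have univ: "UNIV = ({6} \<union> - {6, 8}) \<union> {8 :: nat}" by auto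
  have "run UNIV 0 0 (tape w) = run ({6} \<union> - {6, 8}) 0 0 (tape w) + run {8} 0 0 (tape w)"
    by (subst univ, rule end_prob_Un) auto
  moreover have "run ({6} \<union> - {6, 8}) 0 0 (tape w) = p + r"
    unfolding p_def r_def by (rule end_prob_Un) auto
  ultimately have restart: "run {8} 0 0 (tape w) = 1 - (p + r)"
    by (simp add: run_UNIV)
  have "r \<ge> 0" unfolding r_def by (rule run_nonneg)
  then show "accept_prob power_eq_machine w = p / (p + r)" if "p > 0"
    using that run_nonneg[of "{8}" 0 0 "tape w"] restart
    by (subst accept_prob_eq) (simp_all add: round fields p_def)
  show "accept_prob power_eq_machine w = 0" if "p = 0"
    using that by (simp add: accept_prob_def round fields p_def)
qed

lemma recognizes_power_eq_machine: "recognizes_bounded_error power_eq_machine POWER_EQ"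
  unfolding recognizes_bounded_error_def
\<comment> \<open>Members are accepted with probability 1. For non-members with prefix
  \<open>a b\<close> the bounds below give \<open>?r \<ge> 25 * ?p\<close>, hence acceptance at most
  1/26.\<close>
proof (intro exI[of _ "1 / 4"] conjI allI impI)
  fix w
  let ?p = "run {6} 0 0 (tape w)" and ?r = "run (- {6, 8}) 0 0 (tape w)"
  have p: "?p = ((1 / 25) ^ 9) ^ Suc (length u) / 4" if "w = a # b # u" for u
    unfolding that run_prefix by (simp add: run_accept_counting run_accept_coin)
  have r: "?r = run (- {6, 8}) 3 0 (input_tail u) / 4 +
      run (- {6, 8}) 4 (7 * pythagorean_angle) (input_tail u) / 2" if "w = a # b # u" for u
    unfolding that run_prefix by (simp add: run_reject_coin)
  show "accept_prob power_eq_machine w \<ge> 1 - 1 / 4" if member: "w \<in> POWER_EQ"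
  proof -
    from member obtain u where u: "w = a # b # u" "balanced False 7 u" "balanced True 0 u"
      using POWER_EQ_iff by blast
    have "?r = 0"
      using run_reject_balanced[OF u(2)] run_reject_balanced[OF u(3)] by (simp add: r[OF u(1)])
    moreover have "?p > 0" by (simp add: p[OF u(1)])
    ultimately show ?thesis by (simp add: accept_prob_power_eq(1))
  qed
  show "accept_prob power_eq_machine w \<le> 1 / 4" if nonmember: "w \<notin> POWER_EQ"
  proof (cases "\<exists>u. w = a # b # u")
    case False
    then show ?thesis by (simp add: accept_prob_power_eq(2) run_accept_without_prefix)
  next
    case True
    then obtain u where u: "w = a # b # u" by blast
    \<comment> \<open>The rejection bound of the branch starting at 7, which is the weaker of the
      two.\<close>
    define \<delta> :: real where "\<delta> = (1 / 25) ^ (7 + 8 * length u)"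
    have "\<not> balanced False 7 u \<or> \<not> balanced True 0 u"
      using nonmember u POWER_EQ_iff by blast
    then have "?r \<ge> \<delta> / 4"
    proof
      assume "\<not> balanced False 7 u"
      from run_reject_unbalanced[OF this]
      have "\<delta> \<le> run (- {6, 8}) 4 (7 * pythagorean_angle) (input_tail u)"
        by (simp add: \<delta>_def)
      with run_nonneg[of "- {6, 8}" 3 0 "input_tail u"] show ?thesis
        unfolding r[OF u] using run_nonneg[of "- {6, 8}" 4 "7 * pythagorean_angle" "input_tail u"]
        by linarith
    next
      assume "\<not> balanced True 0 u"
      from run_reject_unbalanced[OF this]
      have "(1 / 25) ^ (8 * length u) \<le> run (- {6, 8}) 3 0 (input_tail u)" by simp
      moreover have "\<delta> \<le> (1 / 25) ^ (8 * length u)"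
        unfolding \<delta>_def by (rule power_decreasing) auto
      ultimately show ?thesis
        unfolding r[OF u] using run_nonneg[of "- {6, 8}" 4 "7 * pythagorean_angle" "input_tail u"]
        by linarith
    qed
    moreover have "?p \<le> \<delta> / 100"
    proof -
      \<comment> \<open>The coin exponent 9 pays off here: \<open>9 * Suc (length u)\<close> exceeds
        the exponent of \<delta> by at least 2, and one spare factor 1/25 suffices.\<close>
      have "((1 / 25 :: real) ^ 9) ^ Suc (length u) \<le> (1 / 25) ^ Suc (7 + 8 * length u)"
        unfolding power_mult[symmetric] by (rule power_decreasing) auto
      also have "\<dots> = \<delta> / 25" by (simp only: \<delta>_def power_Suc)
      finally show ?thesis unfolding p[OF u] by linarith
    qed
    moreover have "?p > 0" by (simp add: p[OF u])
    ultimately show ?thesis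
      by (simp add: accept_prob_power_eq(1) divide_le_eq)
  qed
qed auto

theorem theorem7:
  shows "\<exists>M :: letter rtqcfa. restarting_rtqcfa M \<and> recognizes_bounded_error M POWER_EQ"
  using restarting_power_eq_machine recognizes_power_eq_machine by blast

end
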